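(* Let $F$ be a CNF formula over $n$ Boolean variables and let $S=S(F)\subseteq\{0,1\}^n$ be its set of satisfying assignments. Fix a positive integer $t$ and generate random sets $R_{i,j}$, $0\le i\le n$, $1\le j\le t$, as follows: $R_{0,j}=\{0,1\}^n$ for all $j$, and for $i=1,\ldots,n$ and each $j$, given the previously generated sets, $R_{i,j}\subseteq R_{i-1,j}$ is drawn from a $1$-uniform distribution on subsets of $R_{i-1,j}$ (i.e. each element of $R_{i-1,j}$ belongs to $R_{i,j}$ with probability $1/2$), with the different columns $j$ generated independently. For each $i$ let $\mathcal{D}_i$ denote the distribution of $R_{i,1}$ (which is $i$-uniform on subsets of $\{0,1\}^n$). Consider the procedure: (1) Choose $\delta\in(0,1/3]$ and receive as input any number $L$ with $0\le L\le|S|$. (2) If $|S|<4/\delta$, return $|S|$ and stop. (3) Let $\ell=\max\{0,\lfloor\log_2(\delta L/4)\rfloor\}$. (4) Let $B$ be any number with $B\ge\max_{\ell\le i\le n}\mathrm{Boost}(\mathcal{D}_i,2^i)$. (5) Set $\xi=8/\delta$ and $b=\lceil\xi+2(\xi+\xi^2(B-1))\rceil$. (6) For $i=\ell,\ldots,n$ let $Y_{i,j}=\min\{b,|S\cap R_{i,j}|\}$, $Z_i=\sum_{j=1}^t Y_{i,j}$ and $A_i=Z_i/t$. (7) Let $j^*=\max\{i\ge\ell: A_i\ge(1-\delta)(4/\delta)\}$ and return $\max\{L,A_{j^*}2^{j^*}\}$. Then for any $s>0$, if $t\ge (2b^2/9)\ln(5e^{s})$, the output lies in the range $[(1-\delta)|S|,(1+\delta)|S|]$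 with probability at least $1-\exp(-s)>0$.
   Context: A distribution $\mathcal{D}$ on subsets of a finite set $U$ is $i$-uniform if, for $R\sim\mathcal{D}$, $\Pr[\sigma\in R]=2^{-i}$ for every $\sigma\in U$. For an $i$-uniform distribution $\mathcal{D}$ on subsets of $\{0,1\}^n$ and $M\ge1$, $$\mathrm{Boost}(\mathcal{D},M)=\max_{S\subseteq\{0,1\}^n,\ |S|\ge M}\ \frac{1}{|S|(|S|-1)}\sum_{\sigma,\tau\in S,\ \sigma\ne\tau}\frac{\Pr[\sigma,\tau\in R]}{\Pr[\sigma\in R]\Pr[\tau\in R]},$$ where $R\sim\mathcal{D}$ (sets $S$ with $|S|\le1$ excluded).
   Formalization: The formal theorem also requires B ≥ 1 (when |S| ≥ 4/δ), as the claim fails for some B < 1 (e.g. exact random halving of S={0,1}^14, δ=0.1, L=10240), and makes explicit that at each level i all columns R_{i,j} have the same distribution D_i. *)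

theory Defs
  imports "HOL-Probability.Probability"
begin

datatype literal = Pos nat | Neg nat

type_synonym cnf = "literal list list"

primrec lit_var :: "literal \<Rightarrow> nat" where
  "lit_var (Pos v) = v"
| "lit_var (Neg v) = v"

primrec lit_holds :: "bool list \<Rightarrow> literal \<Rightarrow> bool" where
  "lit_holds \<sigma> (Pos v) = (\<sigma> ! v)"
| "lit_holds \<sigma> (Neg v) = (\<not> \<sigma> ! v)"

definition cnf_over :: "nat \<Rightarrow> cnf \<Rightarrow> bool" where
  "cnf_over n F \<longleftrightarrow> (\<forall>C\<in>set F. \<forall>l\<in>set C. lit_var l < n)"

definition cube :: "nat \<Rightarrow> bool list set" where
  "cube n = {\<sigma>. length \<sigma> = n}"

definition sat_set :: "nat \<Rightarrow> cnf \<Rightarrow> bool list set" where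
  "sat_set n F = {\<sigma> \<in> cube n. \<forall>C\<in>set F. \<exists>l\<in>set C. lit_holds \<sigma> l}"

definition i_uniform :: "nat \<Rightarrow> 'a set \<Rightarrow> 'a set measure \<Rightarrow> bool" where
  "i_uniform i U D \<longleftrightarrow> prob_space D \<and> (AE R in D. R \<subseteq> U) \<and>
     (\<forall>\<sigma>\<in>U. \<P>(R in D. \<sigma> \<in> R) = 1 / 2 ^ i)"

text \<open>
  The value of \<open>boost\<close> can be smaller than 1: if all sets in the support of \<open>D\<close> have the same
  size, pairs are negatively correlated on average.  If \<open>card U \<le> 1\<close> or \<open>m > card U\<close>, no set
  \<open>S\<close> is admissible and the value is unspecified.
\<close>

definition boost :: "'a set \<Rightarrow> 'a set measure \<Rightarrow> nat \<Rightarrow> real" where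
  "boost U D m = (MAX S \<in> {S. S \<subseteq> U \<and> m \<le> card S \<and> 1 < card S}.
     1 / (real (card S) * (real (card S) - 1)) *
     (\<Sum>\<sigma>\<in>S. \<Sum>\<tau>\<in>S - {\<sigma>}.
        \<P>(R in D. \<sigma> \<in> R \<and> \<tau> \<in> R) / (\<P>(R in D. \<sigma> \<in> R) * \<P>(R in D. \<tau> \<in> R))))"

text \<open>
  \<open>R i j\<close> is the set at level \<open>i \<le> n\<close> in column \<open>j \<in> {1..t}\<close>.  Conditionally on each possible
  history \<open>A 0, \<dots>, A (i - 1)\<close> of its column, it follows a 1-uniform distribution on the subsets of
  \<open>A (i - 1)\<close>; which one may depend on \<open>i\<close>, on the column and on the whole history.  As the
  columns are independent, conditioning on the other columns as well would change nothing.
  At each level, all columns have the same law, so that the law of \<open>R i 1\<close> describes every column.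
\<close>

locale nested_random_sets = prob_space M for M :: "'w measure" +
  fixes U :: "'a set" and n t :: nat and R :: "nat \<Rightarrow> nat \<Rightarrow> 'w \<Rightarrow> 'a set"
  assumes measurable_R [measurable]:
      "\<lbrakk>i \<le> n; j \<in> {1..t}\<rbrakk> \<Longrightarrow> R i j \<in> M \<rightarrow>\<^sub>M count_space UNIV"
    and R_0: "\<lbrakk>j \<in> {1..t}; \<omega> \<in> space M\<rbrakk> \<Longrightarrow> R 0 j \<omega> = U"
    and R_step: "\<lbrakk>i \<in> {1..n}; j \<in> {1..t}; H = {\<omega> \<in> space M. \<forall>k<i. R k j \<omega> = A k}; prob H > 0\<rbrakk>
      \<Longrightarrow> i_uniform 1 (A (i - 1)) (distr (uniform_measure M H) (count_space UNIV) (R i j))"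
    and columns_indep: "indep_vars (\<lambda>_. \<Pi>\<^sub>M i\<in>{..n}. count_space UNIV)
      (\<lambda>j \<omega>. \<lambda>i\<in>{..n}. R i j \<omega>) {1..t}"
    and columns_same_law: "\<lbrakk>i \<le> n; j \<in> {1..t}\<rbrakk>
      \<Longrightarrow> distr M (count_space UNIV) (R i j) = distr M (count_space UNIV) (R i 1)"

definition level_law :: "'w measure \<Rightarrow> (nat \<Rightarrow> nat \<Rightarrow> 'w \<Rightarrow> 'a set) \<Rightarrow> nat \<Rightarrow> 'a set measure" where
  "level_law M R i = distr M (count_space UNIV) (R i 1)"

text \<open>The case \<open>L = 0\<close> is the convention \<open>log 2 0 = - \<infinity>\<close>.\<close>

definition start_level :: "real \<Rightarrow> real \<Rightarrow> nat" where
  "start_level \<delta> L = (if L = 0 then 0 else nat (max 0 \<lfloor>log 2 (\<delta> * L / 4)\<rfloor>))"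

definition cutoff :: "real \<Rightarrow> real \<Rightarrow> int" where
  "cutoff \<delta> B = (let \<xi> = 8 / \<delta> in \<lceil>\<xi> + 2 * (\<xi> + \<xi>\<^sup>2 * (B - 1))\<rceil>)"

definition capped_avg :: "nat \<Rightarrow> int \<Rightarrow> 'a set \<Rightarrow> (nat \<Rightarrow> nat \<Rightarrow> 'a set) \<Rightarrow> nat \<Rightarrow> real" where
  "capped_avg t b S r i =
     (\<Sum>j=1..t. min (real_of_int b) (real (card (S \<inter> r i j)))) / real t"

text \<open>
  The procedure run on one outcome \<open>r\<close> of the random sets.  The result is \<open>None\<close> if no level
  reaches the threshold, i.e. if the final maximum does not exist.
\<close>

definition approx_count ::
    "nat \<Rightarrow> nat \<Rightarrow> real \<Rightarrow> real \<Rightarrow> real \<Rightarrow> 'a set \<Rightarrow> (nat \<Rightarrow> nat \<Rightarrow> 'a set) \<Rightarrow> real option" where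
  "approx_count n t \<delta> L B S r =
     (if real (card S) < 4 / \<delta> then Some (real (card S))
      else
        let b = cutoff \<delta> B;
            J = {i \<in> {start_level \<delta> L..n}. capped_avg t b S r i \<ge> (1 - \<delta>) * (4 / \<delta>)}
        in if J = {} then None
           else Some (max L (capped_avg t b S r (Max J) * 2 ^ Max J)))"

end

theory Submission
  imports Defs
begin

text \<open>
  Write \<open>X\<close> for the size of \<open>S \<inter> R i j\<close> and \<open>m = |S| / 2^i\<close> for its mean, and let \<open>q\<close> be the last
  level with \<open>m \<ge> 4 / \<delta>\<close>.  For \<open>i \<in> {q, q + 1}\<close> the boost bounds the variance of \<open>X\<close> by \<open>m + m\<^sup>2 (B - 1)\<close>,
  and the cutoff \<open>b\<close> is chosen so large that truncation costs at most \<open>1 / 8\<close> in the mean.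
  By Hoeffding's inequality, each of the following five deviations has probability at most
  \<open>exp (- 9 t / (2 b\<^sup>2)) \<le> exp (- s) / 5\<close>: the averages at levels \<open>q\<close> and \<open>q + 1\<close> are off by \<open>3 / 2\<close>
  to either side, or the average at level \<open>q + 2\<close> is too large by \<open>3 / 2\<close>.  Otherwise both \<open>q\<close> and
  \<open>q + 1\<close> give accurate estimates, \<open>q\<close> reaches the threshold, and \<open>q + 2\<close> does not.  As the sets are
  nested, no later level does either, so that the selected level is \<open>q\<close> or \<open>q + 1\<close>.
\<close>

section \<open>Conditioning on column histories; marginals of the levels\<close>

context nested_random_sets
begin

text \<open>The bound on \<open>k\<close> is strict: \<open>history (Suc i) j A\<close> fixes levels
  0 to \<open>i\<close> and is exactly the event on which \<open>R_step\<close> conditions level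
  \<open>Suc i\<close>. Functions \<open>A\<close> that agree below the index give the same
  event.\<close>

definition history :: "nat \<Rightarrow> nat \<Rightarrow> (nat \<Rightarrow> 'a set) \<Rightarrow> 'w set" where
  "history i j A = {\<omega> \<in> space M. \<forall>k<i. R k j \<omega> = A k}"

lemma measurable_level_pred:
  assumes "i \<le> n" "j \<in> {1..t}"
  shows "Measurable.pred M (\<lambda>\<omega>. P (R i j \<omega>))"
  by (rule measurable_compose[OF measurable_R[OF assms]]) simp

lemma sets_level:
  assumes "i \<le> n" "j \<in> {1..t}"
  shows "{\<omega> \<in> space M. P (R i j \<omega>)} \<in> events"
  by (rule predE[OF measurable_level_pred[OF assms]])

lemma sets_history [measurable]:
  assumes "i \<le> Suc n" "j \<in> {1..t}"
  shows "history i j A \<in> events"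
proof -
  have "{\<omega> \<in> space M. \<forall>k\<in>{..<i}. R k j \<omega> = A k} \<in> events"
    by (intro predE pred_intros_finite(3) measurable_level_pred) (use assms in auto)
  also have "{\<omega> \<in> space M. \<forall>k\<in>{..<i}. R k j \<omega> = A k} = history i j A"
    by (auto simp: history_def)
  finally show ?thesis .
qed

text \<open>\<open>R_step\<close> speaks only about histories of positive probability. Every other
  history is a null event, so the implication then holds almost everywhere for lack of
  cases.\<close>

lemma AE_history_subset:
  assumes i: "i < n" and j: "j \<in> {1..t}"
  shows "AE \<omega> in M. \<omega> \<in> history (Suc i) j A \<longrightarrow> R (Suc i) j \<omega> \<subseteq> A i"
proof (cases "prob (history (Suc i) j A) > 0")
  case True
  let ?H = "history (Suc i) j A"
  have [measurable]: "?H \<in> events" using i j by simp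
  have "i_uniform 1 (A i) (distr (uniform_measure M ?H) (count_space UNIV) (R (Suc i) j))"
    using R_step[OF _ j history_def True] i by simp
  then have "AE X in distr (uniform_measure M ?H) (count_space UNIV) (R (Suc i) j). X \<subseteq> A i"
    unfolding i_uniform_def by simp
  then have "AE \<omega> in uniform_measure M ?H. R (Suc i) j \<omega> \<subseteq> A i"
    using i j by (subst (asm) AE_distr_iff) auto
  then show ?thesis
    using True by (subst (asm) AE_uniform_measure) (auto simp: emeasure_eq_measure)
next
  case False
  have "AE \<omega> in M. \<omega> \<notin> history (Suc i) j A"
    using False i j by (intro AE_not_in null_setsI) (auto simp: emeasure_eq_measure zero_less_measure_iff)
  then show ?thesis by eventually_elim simp
qed

text \<open>On this history \<open>R i j\<close> equals \<open>A i\<close>, so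
  \<open>x \<in> R i j\<close> holds everywhere or nowhere on it. If \<open>x \<in> A i\<close>,
  1-uniformity supplies the factor 1/2; if not, almost sure inclusion in \<open>A i\<close> makes
  both sides zero. A null history makes both sides zero as well.\<close>

lemma prob_history_mem:
  assumes i: "i < n" and j: "j \<in> {1..t}"
  shows "prob (history (Suc i) j A \<inter> {\<omega> \<in> space M. x \<in> R (Suc i) j \<omega>})
    = prob (history (Suc i) j A \<inter> {\<omega> \<in> space M. x \<in> R i j \<omega>}) / 2"
proof -
  let ?H = "history (Suc i) j A"
  have H [measurable]: "?H \<in> events" using i j by simp
  have E [measurable]: "{\<omega> \<in> space M. x \<in> R (Suc i) j \<omega>} \<in> events"
      "{\<omega> \<in> space M. x \<in> R i j \<omega>} \<in> events"
    using i j by (auto intro: sets_level[where P = "\<lambda>X. x \<in> X"])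
  consider "x \<notin> A i" | "x \<in> A i" "prob ?H = 0" | "x \<in> A i" "prob ?H > 0"
    by (auto simp: zero_less_measure_iff)
  then show ?thesis
  proof cases
    case 1
    have "prob (?H \<inter> {\<omega> \<in> space M. x \<in> R (Suc i) j \<omega>}) = prob {}"
      using AE_history_subset[OF assms, of A] 1
      by (intro finite_measure_eq_AE) (auto elim!: eventually_mono)
    moreover have "?H \<inter> {\<omega> \<in> space M. x \<in> R i j \<omega>} = {}"
      using 1 by (auto simp: history_def)
    ultimately show ?thesis by simp
  next
    case 2
    then have "prob (?H \<inter> X) = 0" if "X \<in> events" for X
      using finite_measure_mono[of "?H \<inter> X" ?H] H that by (simp add: measure_le_0_iff)
    then show ?thesis using E by simp
  next
    case 3
    have "i_uniform 1 (A i) (distr (uniform_measure M ?H) (count_space UNIV) (R (Suc i) j))"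
      using R_step[OF _ j history_def 3(2)] i by simp
    then have "measure (distr (uniform_measure M ?H) (count_space UNIV) (R (Suc i) j)) {X. x \<in> X} = 1 / 2"
      using 3 unfolding i_uniform_def by simp
    then have "measure (uniform_measure M ?H) {\<omega> \<in> space M. x \<in> R (Suc i) j \<omega>} = 1 / 2"
      using i j by (subst (asm) measure_distr) (auto simp: vimage_def Int_def conj_commute)
    then have "prob (?H \<inter> {\<omega> \<in> space M. x \<in> R (Suc i) j \<omega>}) = prob ?H / 2"
      using 3 by (subst (asm) measure_uniform_measure) (auto simp: emeasure_eq_measure field_simps)
    moreover have "?H \<inter> {\<omega> \<in> space M. x \<in> R i j \<omega>} = ?H"
      using 3 by (auto simp: history_def)
    ultimately show ?thesis by simp
  qed
qed

text \<open>Restricting the observed column to \<open>{..<i}\<close> gives an extensional function.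
  For finite \<open>U\<close> there are finitely many of these, and distinct ones describe disjoint
  events.\<close>

lemma history_restrict:
  assumes "\<omega> \<in> space M" "\<forall>k<i. R k j \<omega> \<subseteq> U"
  shows "\<exists>A \<in> {..<i} \<rightarrow>\<^sub>E Pow U. \<omega> \<in> history i j A"
  using assms by (intro bexI[of _ "\<lambda>k\<in>{..<i}. R k j \<omega>"]) (auto simp: history_def)

text \<open>Both claims must go through the induction together: containment of the earlier levels in
  \<open>U\<close> leaves only finitely many histories, so their exceptional null sets can be
  united, and the inclusion obtained in this way puts the next level into \<open>U\<close>.\<close>

lemma AE_levels:
  assumes "finite U" "i \<le> n" "j \<in> {1..t}"
  shows "AE \<omega> in M. (\<forall>k\<le>i. R k j \<omega> \<subseteq> U) \<and> (\<forall>k<i. R (Suc k) j \<omega> \<subseteq> R k j \<omega>)"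
  using assms(2)
proof (induction i)
  case 0
  show ?case using assms R_0 by (intro AE_I2) simp
next
  case (Suc i)
  have "AE \<omega> in M. \<forall>A\<in>{..<Suc i} \<rightarrow>\<^sub>E Pow U. \<omega> \<in> history (Suc i) j A \<longrightarrow> R (Suc i) j \<omega> \<subseteq> A i"
    using assms Suc.prems by (intro AE_finite_allI finite_PiE AE_history_subset) auto
  moreover have "AE \<omega> in M. (\<forall>k\<le>i. R k j \<omega> \<subseteq> U) \<and> (\<forall>k<i. R (Suc k) j \<omega> \<subseteq> R k j \<omega>)"
    using Suc by simp
  ultimately show ?case using AE_space
  proof eventually_elim
    case (elim \<omega>)
    obtain A where A: "A \<in> {..<Suc i} \<rightarrow>\<^sub>E Pow U" "\<omega> \<in> history (Suc i) j A"
      using history_restrict[of \<omega> "Suc i" j] elim by (auto simp: less_Suc_eq_le)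
    then have "R (Suc i) j \<omega> \<subseteq> R i j \<omega>"
      using elim by (auto simp: history_def)
    moreover from this have "R (Suc i) j \<omega> \<subseteq> U"
      using elim by blast
    ultimately show ?case
      using elim by (simp add: le_Suc_eq less_Suc_eq all_conj_distrib imp_disjL)
  qed
qed

lemma AE_level_antimono:
  assumes "finite U" "j \<in> {1..t}"
  shows "AE \<omega> in M. \<forall>i k. i \<le> k \<and> k \<le> n \<longrightarrow> R k j \<omega> \<subseteq> R i j \<omega>"
  using AE_levels[OF assms(1) order_refl assms(2)]
proof eventually_elim
  case (elim \<omega>)
  have "R k j \<omega> \<subseteq> R i j \<omega>" if "i \<le> k" "k \<le> n" for i k
    using that
  proof (induction k rule: dec_induct)
    case (step k)
    then have "R (Suc k) j \<omega> \<subseteq> R k j \<omega>" "R k j \<omega> \<subseteq> R i j \<omega>"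
      using elim by simp_all
    then show ?case by blast
  qed simp
  then show ?case by blast
qed

text \<open>Law of total probability: the histories with values in \<open>Pow U\<close> are disjoint
  and, by \<open>AE_levels\<close>, cover the space up to a null set.\<close>

lemma prob_sum_histories:
  assumes "finite U" and i: "i \<le> n" and j: "j \<in> {1..t}" and E [measurable]: "E \<in> events"
  shows "prob E = (\<Sum>A\<in>{..<Suc i} \<rightarrow>\<^sub>E Pow U. prob (history (Suc i) j A \<inter> E))"
proof -
  let ?I = "{..<Suc i} \<rightarrow>\<^sub>E Pow U"
  have fin: "finite ?I" using assms by (intro finite_PiE) auto
  have [measurable]: "history (Suc i) j A \<in> events" for A
    using i j by simp
  have "prob E = prob (\<Union>A\<in>?I. history (Suc i) j A \<inter> E)"
  proof (rule finite_measure_eq_AE)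
    show "AE \<omega> in M. (\<omega> \<in> E) = (\<omega> \<in> (\<Union>A\<in>?I. history (Suc i) j A \<inter> E))"
      using AE_levels[OF assms(1) i j] AE_space
    proof eventually_elim
      case (elim \<omega>)
      then show ?case using history_restrict[of \<omega> "Suc i" j] by (auto simp: less_Suc_eq_le)
    qed
    show "(\<Union>A\<in>?I. history (Suc i) j A \<inter> E) \<in> events"
      using fin by (intro sets.finite_UN) auto
  qed fact
  also have "\<dots> = (\<Sum>A\<in>?I. prob (history (Suc i) j A \<inter> E))"
  proof (rule finite_measure_finite_Union[OF fin])
    show "disjoint_family_on (\<lambda>A. history (Suc i) j A \<inter> E) ?I"
      unfolding disjoint_family_on_def
    proof (intro ballI impI)
      fix A B assume "A \<in> ?I" "B \<in> ?I" "A \<noteq> B"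
      then obtain k where "k < Suc i" "A k \<noteq> B k" by (metis PiE_ext lessThan_iff)
      then show "(history (Suc i) j A \<inter> E) \<inter> (history (Suc i) j B \<inter> E) = {}"
        by (auto simp: history_def)
    qed
  qed auto
  finally show ?thesis .
qed

text \<open>The conditional 1-uniform laws may differ between histories, so the halving is applied
  to each history separately and the results are summed.\<close>

lemma prob_level_mem:
  assumes "finite U" "i \<le> n" "j \<in> {1..t}" "x \<in> U"
  shows "prob {\<omega> \<in> space M. x \<in> R i j \<omega>} = 1 / 2 ^ i"
  using assms(2)
proof (induction i)
  case 0
  have "{\<omega> \<in> space M. x \<in> R 0 j \<omega>} = space M"
    using R_0 assms by auto
  then show ?case by (simp add: prob_space)
next
  case (Suc i)
  have E: "{\<omega> \<in> space M. x \<in> R k j \<omega>} \<in> events" if "k \<le> n" for k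
    using that assms by (intro sets_level[where P = "\<lambda>X. x \<in> X"]) auto
  have "prob {\<omega> \<in> space M. x \<in> R (Suc i) j \<omega>}
      = (\<Sum>A\<in>{..<Suc i} \<rightarrow>\<^sub>E Pow U. prob (history (Suc i) j A \<inter> {\<omega> \<in> space M. x \<in> R (Suc i) j \<omega>}))"
    using Suc.prems assms E by (intro prob_sum_histories) auto
  also have "\<dots> = (\<Sum>A\<in>{..<Suc i} \<rightarrow>\<^sub>E Pow U. prob (history (Suc i) j A \<inter> {\<omega> \<in> space M. x \<in> R i j \<omega>})) / 2"
    using Suc.prems assms by (simp add: prob_history_mem sum_divide_distrib)
  also have "\<dots> = prob {\<omega> \<in> space M. x \<in> R i j \<omega>} / 2"
    using Suc.prems assms E by (subst prob_sum_histories[of i j]) auto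
  finally have "prob {\<omega> \<in> space M. x \<in> R (Suc i) j \<omega>} = prob {\<omega> \<in> space M. x \<in> R i j \<omega>} / 2" .
  then show ?case using Suc by simp
qed

end

section \<open>Moments of the level counts and the cost of truncation\<close>

text \<open>The parabola \<open>(x - m)\<^sup>2 / (4 * (b - m))\<close> is tangent to the line
  \<open>x - b\<close> at \<open>x = 2 * b - m\<close>, hence dominates the truncation loss. Taking
  expectations with \<open>m\<close> the mean bounds the expected loss by the variance over
  \<open>4 * (b - m)\<close>.\<close>

lemma min_ge_quadratic:
  fixes b m x :: real
  assumes "m < b"
  shows "x - (x - m)\<^sup>2 / (4 * (b - m)) \<le> min b x"
proof -
  have "b - x + (x - m)\<^sup>2 / (4 * (b - m)) = (x - m - 2 * (b - m))\<^sup>2 / (4 * (b - m))"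
    using assms by (simp add: divide_simps) (simp add: power2_eq_square algebra_simps)
  also have "\<dots> \<ge> 0" using assms by simp
  finally have "x - (x - m)\<^sup>2 / (4 * (b - m)) \<le> b" by linarith
  moreover have "(x - m)\<^sup>2 / (4 * (b - m)) \<ge> 0" using assms by simp
  ultimately show ?thesis by simp
qed

context nested_random_sets
begin

lemma measurable_level_fun:
  fixes g :: "'a set \<Rightarrow> real"
  assumes "i \<le> n" "j \<in> {1..t}"
  shows "(\<lambda>\<omega>. g (R i j \<omega>)) \<in> borel_measurable M"
  by (rule measurable_compose[OF measurable_R[OF assms]]) simp

text \<open>The count takes only values up to \<open>card S\<close>, so every function of it is
  bounded. The arbitrary \<open>g\<close> covers the mean, the squares and the truncation at
  once.\<close>

lemma integrable_level_card:
  fixes g :: "nat \<Rightarrow> real"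
  assumes "finite S" "i \<le> n" "j \<in> {1..t}"
  shows "integrable M (\<lambda>\<omega>. g (card (S \<inter> R i j \<omega>)))"
proof (rule integrable_const_bound)
  show "AE \<omega> in M. norm (g (card (S \<inter> R i j \<omega>))) \<le> (MAX k\<in>{..card S}. norm (g k))"
    using assms by (intro AE_I2 Max_ge) (auto intro!: imageI card_mono)
qed (rule measurable_level_fun[OF assms(2,3)])

text \<open>The boost is computed from column 1; equality of the column laws transfers it to column
  \<open>j\<close>.\<close>

lemma prob_level_law:
  assumes "i \<le> n" "j \<in> {1..t}"
  shows "\<P>(X in level_law M R i. P X) = prob {\<omega> \<in> space M. P (R i j \<omega>)}"
proof -
  have "level_law M R i = distr M (count_space UNIV) (R i j)"
    using columns_same_law[OF assms] by (simp add: level_law_def)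
  then show ?thesis
    using assms by (simp add: measure_distr vimage_def Int_def conj_commute)
qed

lemma expectation_level_card:
  assumes "finite U" "S \<subseteq> U" "i \<le> n" "j \<in> {1..t}"
  shows "expectation (\<lambda>\<omega>. real (card (S \<inter> R i j \<omega>))) = real (card S) / 2 ^ i"
proof -
  have fin: "finite S" using assms finite_subset by auto
  have E [measurable]: "{\<omega> \<in> space M. x \<in> R i j \<omega>} \<in> events" for x
    using assms by (intro sets_level[where P = "\<lambda>X. x \<in> X"]) auto
  have "expectation (\<lambda>\<omega>. real (card (S \<inter> R i j \<omega>)))
      = expectation (\<lambda>\<omega>. \<Sum>x\<in>S. indicat_real {\<omega> \<in> space M. x \<in> R i j \<omega>} \<omega>)"
    using fin by (intro Bochner_Integration.integral_cong)
      (auto simp: indicator_def sum.If_cases Int_def)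
  also have "\<dots> = (\<Sum>x\<in>S. prob {\<omega> \<in> space M. x \<in> R i j \<omega>})"
    by (subst Bochner_Integration.integral_sum) (auto intro!: integrable_indicator simp: emeasure_eq_measure)
  also have "\<dots> = real (card S) / 2 ^ i"
    using assms by (simp add: prob_level_mem subset_iff)
  finally show ?thesis .
qed

text \<open>The squared count is a count of ordered pairs. Diagonal pairs contribute the mean; the
  others form the sum that the boost controls.\<close>

lemma expectation_level_card_sq:
  assumes "finite U" "S \<subseteq> U" "i \<le> n" "j \<in> {1..t}"
  shows "expectation (\<lambda>\<omega>. (real (card (S \<inter> R i j \<omega>)))\<^sup>2)
    = real (card S) / 2 ^ i + (\<Sum>x\<in>S. \<Sum>y\<in>S - {x}. prob {\<omega> \<in> space M. x \<in> R i j \<omega> \<and> y \<in> R i j \<omega>})"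
proof -
  have fin: "finite S" using assms finite_subset by auto
  let ?E = "\<lambda>x y. {\<omega> \<in> space M. x \<in> R i j \<omega> \<and> y \<in> R i j \<omega>}"
  have E [measurable]: "?E x y \<in> events" for x y
    using assms by (intro sets_level[where P = "\<lambda>X. x \<in> X \<and> y \<in> X"]) auto
  have "expectation (\<lambda>\<omega>. (real (card (S \<inter> R i j \<omega>)))\<^sup>2)
      = expectation (\<lambda>\<omega>. \<Sum>x\<in>S. \<Sum>y\<in>S. indicat_real (?E x y) \<omega>)"
  proof (rule Bochner_Integration.integral_cong[OF refl])
    fix \<omega> assume "\<omega> \<in> space M"
    then have "(\<Sum>x\<in>S. \<Sum>y\<in>S. indicat_real (?E x y) \<omega>)
        = (\<Sum>x\<in>S. \<Sum>y\<in>S. (if x \<in> R i j \<omega> then 1 else 0) * (if y \<in> R i j \<omega> then 1 else 0))"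
      by (intro sum.cong refl) (auto simp: indicator_def)
    also have "\<dots> = (real (card (S \<inter> R i j \<omega>)))\<^sup>2"
      using fin by (simp add: sum_product[symmetric] sum.If_cases Int_def power2_eq_square)
    finally show "(real (card (S \<inter> R i j \<omega>)))\<^sup>2 = (\<Sum>x\<in>S. \<Sum>y\<in>S. indicat_real (?E x y) \<omega>)" ..
  qed
  also have "\<dots> = (\<Sum>x\<in>S. \<Sum>y\<in>S. prob (?E x y))"
    by (subst Bochner_Integration.integral_sum Bochner_Integration.integral_sum)+
      (auto intro!: integrable_indicator Bochner_Integration.integrable_sum simp: emeasure_eq_measure)
  also have "\<dots> = (\<Sum>x\<in>S. prob {\<omega> \<in> space M. x \<in> R i j \<omega>} + (\<Sum>y\<in>S - {x}. prob (?E x y)))"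
    using fin by (intro sum.cong refl) (simp add: sum.remove)
  also have "\<dots> = real (card S) / 2 ^ i + (\<Sum>x\<in>S. \<Sum>y\<in>S - {x}. prob (?E x y))"
    using assms by (simp add: sum.distrib prob_level_mem subset_iff)
  finally show ?thesis .
qed

text \<open>\<open>S\<close> itself is admissible in the maximum that defines the boost, and as all
  marginals are \<open>1 / 2 ^ i\<close>, every denominator there is
  \<open>1 / 4 ^ i\<close>.\<close>

lemma sum_prob_level_laws_le:
  assumes "finite U" "S \<subseteq> U" "2 ^ i \<le> card S" "1 < card S" "i \<le> n" "j \<in> {1..t}"
    and B: "boost U (level_law M R i) (2 ^ i) \<le> B" "0 \<le> B"
  shows "(\<Sum>x\<in>S. \<Sum>y\<in>S - {x}. prob {\<omega> \<in> space M. x \<in> R i j \<omega> \<and> y \<in> R i j \<omega>})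
    \<le> B * (real (card S) / 2 ^ i)\<^sup>2"
proof -
  let ?D = "level_law M R i" and ?N = "real (card S)"
  let ?T = "\<lambda>S. 1 / (real (card S) * (real (card S) - 1)) *
     (\<Sum>\<sigma>\<in>S. \<Sum>\<tau>\<in>S - {\<sigma>}.
        \<P>(R in ?D. \<sigma> \<in> R \<and> \<tau> \<in> R) / (\<P>(R in ?D. \<sigma> \<in> R) * \<P>(R in ?D. \<tau> \<in> R)))"
  let ?s = "\<Sum>x\<in>S. \<Sum>y\<in>S - {x}. prob {\<omega> \<in> space M. x \<in> R i j \<omega> \<and> y \<in> R i j \<omega>}"
  have "?T S \<le> boost U ?D (2 ^ i)"
    unfolding boost_def
  proof (rule Max_ge)
    show "?T S \<in> ?T ` {S. S \<subseteq> U \<and> 2 ^ i \<le> card S \<and> 1 < card S}"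
      using assms by (intro imageI) simp
    have "finite {S. S \<subseteq> U \<and> 2 ^ i \<le> card S \<and> 1 < card S}"
      by (rule finite_subset[of _ "Pow U"]) (use assms in auto)
    then show "finite (?T ` {S. S \<subseteq> U \<and> 2 ^ i \<le> card S \<and> 1 < card S})"
      by (rule finite_imageI)
  qed
  also have "\<dots> \<le> B" by fact
  also have "?T S = 1 / (?N * (?N - 1)) * (4 ^ i * ?s)"
  proof -
    have "\<P>(R in ?D. x \<in> R \<and> y \<in> R) / (\<P>(R in ?D. x \<in> R) * \<P>(R in ?D. y \<in> R))
        = 4 ^ i * prob {\<omega> \<in> space M. x \<in> R i j \<omega> \<and> y \<in> R i j \<omega>}" if "x \<in> S" "y \<in> S" for x y
      using that assms
      by (simp add: prob_level_law[of i j] prob_level_mem subset_iff flip: power_mult_distrib)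
    then show ?thesis
      by (simp add: sum_distrib_left)
  qed
  finally have "4 ^ i * ?s \<le> B * (?N * (?N - 1))"
    using assms by (simp add: field_simps)
  \<comment> \<open>Enlarging \<open>?N - 1\<close> to \<open>?N\<close> is where
    \<open>0 \<le> B\<close> enters.\<close>
  also have "\<dots> \<le> B * (?N * ?N)"
    using B by (intro mult_left_mono) auto
  finally have "?s \<le> B * (?N * ?N) / 4 ^ i"
    by (simp add: field_simps)
  then show ?thesis
    by (simp add: power2_eq_square flip: power_mult_distrib)
qed

text \<open>With \<open>V\<close> the variance bound at mean \<open>\<xi>\<close>, the cutoff
  exceeds the true mean by at least \<open>2 * V\<close>. The loss is therefore at most
  \<open>V / (8 * V) = 1 / 8\<close>.\<close>

lemma expectation_capped_ge:
  assumes "finite U" "S \<subseteq> U" "2 ^ i \<le> card S" "1 < card S" "i \<le> n" "j \<in> {1..t}"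
    and B: "boost U (level_law M R i) (2 ^ i) \<le> B" "1 \<le> B"
    and \<xi>: "real (card S) / 2 ^ i \<le> \<xi>" and b: "\<xi> + 2 * (\<xi> + \<xi>\<^sup>2 * (B - 1)) \<le> b"
  shows "real (card S) / 2 ^ i - 1 / 8 \<le> expectation (\<lambda>\<omega>. min b (real (card (S \<inter> R i j \<omega>))))"
proof -
  define m where "m = real (card S) / 2 ^ i"
  define V where "V = \<xi> + \<xi>\<^sup>2 * (B - 1)"
  let ?X = "\<lambda>\<omega>. real (card (S \<inter> R i j \<omega>))"
  have fin: "finite S" using assms finite_subset by auto
  have m: "0 < m" "m \<le> \<xi>" using assms by (auto simp: m_def)
  have V: "0 < V" using m B by (auto simp: V_def intro!: add_pos_nonneg)
  have bm: "2 * V \<le> b - m" using b m by (simp add: V_def)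
  have int: "integrable M ?X" "integrable M (\<lambda>\<omega>. (?X \<omega>)\<^sup>2)" "integrable M (\<lambda>\<omega>. (?X \<omega> - m)\<^sup>2)"
      "integrable M (\<lambda>\<omega>. min b (?X \<omega>))"
    using integrable_level_card[OF fin assms(5,6), of real]
      integrable_level_card[OF fin assms(5,6), of "\<lambda>k. (real k)\<^sup>2"]
      integrable_level_card[OF fin assms(5,6), of "\<lambda>k. (real k - m)\<^sup>2"]
      integrable_level_card[OF fin assms(5,6), of "\<lambda>k. min b (real k)"]
    by simp_all
  have EX: "expectation ?X = m"
    unfolding m_def using assms by (intro expectation_level_card)
  have "expectation (\<lambda>\<omega>. (?X \<omega> - m)\<^sup>2) = expectation (\<lambda>\<omega>. (?X \<omega>)\<^sup>2) - m\<^sup>2"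
    using variance_eq[OF int(1,2)] by (simp add: EX)
  also have "\<dots> \<le> m + B * m\<^sup>2 - m\<^sup>2"
    using expectation_level_card_sq[OF assms(1,2,5,6)] sum_prob_level_laws_le[OF assms(1-7)] B
    by (simp add: m_def)
  also have "\<dots> = m + m\<^sup>2 * (B - 1)" by (simp add: algebra_simps)
  \<comment> \<open>Replacing \<open>m\<close> by the larger \<open>\<xi>\<close> needs a
    nonnegative factor \<open>B - 1\<close>. The boost alone does not guarantee this, since it can
    be below 1; hence the condition \<open>1 \<le> B\<close>.\<close>
  also have "\<dots> \<le> V"
    unfolding V_def using m B by (intro add_mono mult_right_mono power_mono) auto
  finally have Var: "expectation (\<lambda>\<omega>. (?X \<omega> - m)\<^sup>2) \<le> V" .
  have "expectation (\<lambda>\<omega>. (?X \<omega> - m)\<^sup>2) / (4 * (b - m)) \<le> V / (4 * (2 * V))"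
    using Var V bm by (intro frac_le mult_left_mono) auto
  also have "\<dots> = 1 / 8" using V by simp
  finally have "m - 1 / 8 \<le> m - expectation (\<lambda>\<omega>. (?X \<omega> - m)\<^sup>2) / (4 * (b - m))" by simp
  also have "\<dots> = expectation (\<lambda>\<omega>. ?X \<omega> - (?X \<omega> - m)\<^sup>2 / (4 * (b - m)))"
    using int EX by simp
  also have "\<dots> \<le> expectation (\<lambda>\<omega>. min b (?X \<omega>))"
    using int V bm by (intro integral_mono min_ge_quadratic) auto
  finally show ?thesis by (simp add: m_def)
qed

lemma expectation_capped_le:
  assumes "finite U" "S \<subseteq> U" "i \<le> n" "j \<in> {1..t}"
  shows "expectation (\<lambda>\<omega>. min b (real (card (S \<inter> R i j \<omega>)))) \<le> real (card S) / 2 ^ i"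
proof -
  have fin: "finite S" using assms finite_subset by auto
  have "expectation (\<lambda>\<omega>. min b (real (card (S \<inter> R i j \<omega>)))) \<le> expectation (\<lambda>\<omega>. real (card (S \<inter> R i j \<omega>)))"
    using integrable_level_card[OF fin assms(3,4), of real]
      integrable_level_card[OF fin assms(3,4), of "\<lambda>k. min b (real k)"]
    by (intro integral_mono) auto
  also have "\<dots> = real (card S) / 2 ^ i"
    using assms by (rule expectation_level_card)
  finally show ?thesis .
qed

section \<open>Concentration of the averages\<close>

lemma measurable_capped_avg [measurable]:
  assumes "i \<le> n"
  shows "(\<lambda>\<omega>. capped_avg t b S (\<lambda>i j. R i j \<omega>) i) \<in> borel_measurable M"
  unfolding capped_avg_def using assms
  by (intro borel_measurable_divide borel_measurable_sum borel_measurable_const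
      measurable_level_fun[where g = "\<lambda>X. min (real_of_int b) (real (card (S \<inter> X)))"]) auto

text \<open>Hoeffding's inequality at a fixed level: the \<open>t\<close> columns give independent,
  identically distributed summands with values in \<open>[0, b]\<close>.\<close>

lemma capped_avg_tail:
  fixes b :: int and S :: "'a set"
  assumes "i \<le> n" "0 < t" "0 < b" "0 \<le> \<epsilon>"
  defines "E \<equiv> expectation (\<lambda>\<omega>. min b (real (card (S \<inter> R i 1 \<omega>))))"
    and "A \<equiv> \<lambda>\<omega>. capped_avg t b S (\<lambda>i j. R i j \<omega>) i"
  shows "prob {\<omega> \<in> space M. E + \<epsilon> \<le> A \<omega>} \<le> exp (- 2 * real t * \<epsilon>\<^sup>2 / b\<^sup>2)"
    and "prob {\<omega> \<in> space M. A \<omega> \<le> E - \<epsilon>} \<le> exp (- 2 * real t * \<epsilon>\<^sup>2 / b\<^sup>2)"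
proof -
  let ?g = "\<lambda>X. min (real_of_int b) (real (card (S \<inter> X)))"
  let ?Y = "\<lambda>j \<omega>. ?g (R i j \<omega>)"
  interpret Hoeffding_ineq_iid M "{1..t}" ?Y "?Y 1" 0 "real_of_int b" E
  proof unfold_locales
    \<comment> \<open>Independence is given for whole columns; projecting each to its level
      \<open>i\<close> and truncating the count preserves it.\<close>
    have "indep_vars (\<lambda>_. borel) (\<lambda>j \<omega>. ?g ((\<lambda>i\<in>{..n}. R i j \<omega>) i)) {1..t}"
      by (rule indep_vars_compose2[OF columns_indep])
        (use assms in \<open>auto intro!: measurable_compose[OF measurable_component_singleton]\<close>)
    then show "indep_vars (\<lambda>_. borel) ?Y {1..t}"
      using assms by simp
    show "distr M borel (?Y j) = distr M borel (?Y 1)" if "j \<in> {1..t}" for j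
    proof -
      have law: "distr M borel (?Y k) = distr (distr M (count_space UNIV) (R i k)) borel ?g" if "k \<in> {1..t}" for k
        using that assms by (subst distr_distr) (auto simp: comp_def)
      have "1 \<in> {1..t}" using assms by simp
      then show ?thesis
        by (simp only: law that columns_same_law[OF assms(1) that])
    qed
    show "?Y 1 \<in> borel_measurable M"
      using assms by (intro measurable_level_fun) auto
    show "AE \<omega> in M. ?Y 1 \<omega> \<in> {0..real_of_int b}"
      using assms by (intro AE_I2) simp
  qed (simp_all add: E_def)
  show "prob {\<omega> \<in> space M. E + \<epsilon> \<le> A \<omega>} \<le> exp (- 2 * real t * \<epsilon>\<^sup>2 / b\<^sup>2)"
    using Hoeffding_ineq_ge'[of \<epsilon>] assms(1-4) by (simp add: A_def capped_avg_def)
  show "prob {\<omega> \<in> space M. A \<omega> \<le> E - \<epsilon>} \<le> exp (- 2 * real t * \<epsilon>\<^sup>2 / b\<^sup>2)"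
    using Hoeffding_ineq_le'[of \<epsilon>] assms(1-4) by (simp add: A_def capped_avg_def)
qed

end

section \<open>Deterministic analysis of the procedure\<close>

text \<open>Trades the option and the maximum of a possibly empty set for bounded quantifiers, so
  that a selected level can be exhibited and measurability can be read off.\<close>

lemma approx_count_eq_Some_iff:
  fixes t :: nat and \<delta> B :: real and S :: "'a set" and r :: "nat \<Rightarrow> nat \<Rightarrow> 'a set"
  assumes "4 / \<delta> \<le> real (card S)"
  defines "A \<equiv> capped_avg t (cutoff \<delta> B) S r" and "c \<equiv> (1 - \<delta>) * (4 / \<delta>)"
  shows "approx_count n t \<delta> L B S r = Some v \<longleftrightarrow>
    (\<exists>k\<in>{start_level \<delta> L..n}. c \<le> A k \<and> (\<forall>i\<in>{start_level \<delta> L..n}. c \<le> A i \<longrightarrow> i \<le> k) \<and>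
      v = max L (A k * 2 ^ k))"
proof -
  let ?J = "{i \<in> {start_level \<delta> L..n}. c \<le> A i}"
  have eq: "approx_count n t \<delta> L B S r = (if ?J = {} then None else Some (max L (A (Max ?J) * 2 ^ Max ?J)))"
    using assms(1) by (simp add: approx_count_def Let_def A_def c_def)
  have "(if ?J = {} then None else Some (max L (A (Max ?J) * 2 ^ Max ?J))) = Some v
    \<longleftrightarrow> (\<exists>k. k \<in> ?J \<and> (\<forall>i\<in>?J. i \<le> k) \<and> v = max L (A k * 2 ^ k))"
  proof (cases "?J = {}")
    case False
    have "k \<in> ?J \<and> (\<forall>i\<in>?J. i \<le> k) \<longleftrightarrow> k = Max ?J" for k
      using Max_eq_iff[of ?J k] False by auto
    note is_Max = this
    have "(\<exists>k. k \<in> ?J \<and> (\<forall>i\<in>?J. i \<le> k) \<and> v = max L (A k * 2 ^ k))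
        \<longleftrightarrow> v = max L (A (Max ?J) * 2 ^ Max ?J)"
      by (simp only: conj_assoc[symmetric] is_Max simp_thms)
    then show ?thesis
      using False by (simp only: if_False option.inject eq_commute[of v])
  next
    case True
    then show ?thesis by (simp only: empty_iff) simp
  qed
  then show ?thesis
    unfolding eq by (simp only: mem_Collect_eq Ball_def Bex_def conj_assoc imp_conjL)
qed

text \<open>Level \<open>q\<close> reaches the threshold because its mean is at least
  \<open>4 / \<delta>\<close> and its relative error at most \<open>\<delta>\<close>; levels from
  \<open>q + 2\<close> on do not reach it. So \<open>q\<close> or \<open>Suc q\<close> is selected,
  and scaling by \<open>2 ^ k\<close> preserves the relative error.\<close>

lemma approx_count_within:
  fixes S :: "'a set" and \<delta> :: real
  defines "N \<equiv> real (card S)"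
  assumes \<delta>: "0 < \<delta>" "\<delta> \<le> 1 / 3" and N: "4 / \<delta> \<le> N" and L: "L \<le> N"
    and q: "start_level \<delta> L \<le> q" "q < n" "4 / \<delta> \<le> N / 2 ^ q"
    and A_eq: "A = capped_avg t (cutoff \<delta> B) S r"
    and acc: "\<And>i. i \<in> {q, Suc q} \<Longrightarrow> \<bar>A i - N / 2 ^ i\<bar> \<le> \<delta> * (N / 2 ^ i)"
    and low: "\<And>i. i \<in> {q + 2..n} \<Longrightarrow> A i < (1 - \<delta>) * (4 / \<delta>)"
  shows "\<exists>v. approx_count n t \<delta> L B S r = Some v \<and> v \<in> {(1 - \<delta>) * N..(1 + \<delta>) * N}"
proof -
  define c where "c = (1 - \<delta>) * (4 / \<delta>)"
  have "c \<le> (1 - \<delta>) * (N / 2 ^ q)"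
    unfolding c_def using \<delta> q by (intro mult_left_mono) auto
  also have "\<dots> = N / 2 ^ q - \<delta> * (N / 2 ^ q)" by (simp only: left_diff_distrib mult_1)
  also have "\<dots> \<le> A q" using acc[of q] by simp
  finally have cq: "c \<le> A q" .
  define k where "k = (if c \<le> A (Suc q) then Suc q else q)"
  have k: "k \<in> {q, Suc q}" "c \<le> A k" using cq by (auto simp: k_def)
  have k_max: "i \<le> k" if "i \<in> {start_level \<delta> L..n}" "c \<le> A i" for i
    using that low[of i] unfolding c_def[symmetric] k_def
    by (cases "i \<le> q"; cases "i = Suc q") auto
  have "approx_count n t \<delta> L B S r = Some (max L (A k * 2 ^ k))"
    using k k_max q
    by (subst approx_count_eq_Some_iff) (use N in \<open>auto simp: N_def c_def A_eq intro!: bexI[of _ k]\<close>)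
  moreover have "max L (A k * 2 ^ k) \<in> {(1 - \<delta>) * N..(1 + \<delta>) * N}"
  proof -
    have N0: "0 \<le> N" by (simp add: N_def)
    have "A k * 2 ^ k - N = (A k - N / 2 ^ k) * 2 ^ k"
      by (simp add: left_diff_distrib)
    then have "\<bar>A k * 2 ^ k - N\<bar> = \<bar>A k - N / 2 ^ k\<bar> * 2 ^ k"
      by (simp add: abs_mult)
    also have "\<dots> \<le> \<delta> * (N / 2 ^ k) * 2 ^ k"
      using acc[OF k(1)] by (intro mult_right_mono) auto
    finally have "\<bar>A k * 2 ^ k - N\<bar> \<le> \<delta> * N" by simp
    \<comment> \<open>The maximum with \<open>L\<close> cannot push the output too high, because
      \<open>L \<le> N \<le> (1 + \<delta>) * N\<close>.\<close>
    moreover have "0 \<le> \<delta> * N" using \<delta> N0 by simp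
    ultimately show ?thesis
      using L by (auto simp: algebra_simps abs_le_iff max_def)
  qed
  ultimately show ?thesis by blast
qed

text \<open>Powers of two are integers, so comparing them with \<open>x\<close> amounts to comparing
  them with its floor.\<close>

lemma crossing_level:
  fixes x :: real
  assumes "1 \<le> x"
  obtains q :: nat where "2 ^ q \<le> x" "x < 2 ^ Suc q"
proof -
  obtain q where q: "2 ^ q \<le> nat \<lfloor>x\<rfloor>" "nat \<lfloor>x\<rfloor> < 2 ^ (q + 1)"
    using ex_power_ivl1[of 2 "nat \<lfloor>x\<rfloor>"] assms by (auto simp: le_nat_iff)
  have "real (2 ^ q) \<le> x"
    using q(1) assms by (simp add: le_nat_iff le_floor_iff)
  moreover have "x < real (2 ^ Suc q)"
    using q(2) assms by (simp add: nat_less_iff floor_less_iff)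
  ultimately show ?thesis using that by simp
qed

text \<open>The logarithm is strictly below \<open>q + 1\<close>, so its floor is at most
  \<open>q\<close>; since \<open>0 \<le> q\<close>, clipping negative values to 0 keeps the
  bound.\<close>

lemma start_level_le:
  assumes "0 < \<delta>" "0 \<le> L" "\<delta> * L / 4 < 2 ^ Suc q"
  shows "start_level \<delta> L \<le> q"
proof (cases "L = 0")
  case False
  then have pos: "0 < \<delta> * L / 4" using assms by simp
  have "log 2 (\<delta> * L / 4) < log 2 (2 ^ Suc q)"
    using pos assms by (subst log_less_cancel_iff) auto
  also have "\<dots> = real (Suc q)" by (rule log_pow_cancel) auto
  finally show ?thesis
    using False by (simp add: start_level_def nat_le_iff floor_le_iff)
qed (simp add: start_level_def)

section \<open>Bounding the failure probability\<close>

context nested_random_sets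
begin

text \<open>Lets a single bound at level \<open>q + 2\<close> control all later levels, so that the
  number of bad events does not grow with \<open>n\<close>.\<close>

lemma AE_capped_avg_antimono:
  assumes "finite U" "S \<subseteq> U"
  shows "AE \<omega> in M. \<forall>i k. i \<le> k \<and> k \<le> n \<longrightarrow>
    capped_avg t b S (\<lambda>i j. R i j \<omega>) k \<le> capped_avg t b S (\<lambda>i j. R i j \<omega>) i"
proof -
  have fin: "finite S" using assms finite_subset by auto
  have "AE \<omega> in M. \<forall>j\<in>{1..t}. \<forall>i k. i \<le> k \<and> k \<le> n \<longrightarrow> R k j \<omega> \<subseteq> R i j \<omega>"
    using assms by (intro AE_finite_allI AE_level_antimono) auto
  then show ?thesis
  proof eventually_elim
    case (elim \<omega>)
    show ?case
    proof (intro allI impI)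
      fix i k assume "i \<le> k \<and> k \<le> n"
      then have "R k j \<omega> \<subseteq> R i j \<omega>" if "j \<in> {1..t}" for j
        using elim that by blast
      then show "capped_avg t b S (\<lambda>i j. R i j \<omega>) k \<le> capped_avg t b S (\<lambda>i j. R i j \<omega>) i"
        unfolding capped_avg_def
        by (intro divide_right_mono sum_mono min.mono) (auto intro!: card_mono fin)
    qed
  qed
qed

text \<open>Passing from the failure probability to its complement requires the success set to be an
  event; it is a finite combination of comparisons between measurable averages and
  constants.\<close>

lemma sets_approx_count:
  assumes "4 / \<delta> \<le> real (card S)"
  shows "{\<omega> \<in> space M. \<exists>v. approx_count n t \<delta> L B S (\<lambda>i j. R i j \<omega>) = Some v \<and> v \<in> {lo..hi}} \<in> events"
proof -
  define A where "A = (\<lambda>i \<omega>. capped_avg t (cutoff \<delta> B) S (\<lambda>i j. R i j \<omega>) i)"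
  define c where "c = (1 - \<delta>) * (4 / \<delta>)"
  let ?I = "{start_level \<delta> L..n}"
  have [measurable]: "A i \<in> borel_measurable M" if "i \<in> ?I" for i
    using that unfolding A_def by simp
  have "{\<omega> \<in> space M. \<exists>v. approx_count n t \<delta> L B S (\<lambda>i j. R i j \<omega>) = Some v \<and> v \<in> {lo..hi}} =
    {\<omega> \<in> space M. \<exists>k\<in>?I. c \<le> A k \<omega> \<and> (\<forall>i\<in>?I. c \<le> A i \<omega> \<longrightarrow> i \<le> k) \<and>
      lo \<le> max L (A k \<omega> * 2 ^ k) \<and> max L (A k \<omega> * 2 ^ k) \<le> hi}"
    unfolding approx_count_eq_Some_iff[OF assms] A_def c_def atLeastAtMost_iff by blast
  also have "\<dots> \<in> events" by measurable
  finally show ?thesis .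
qed

lemma approx_count_prob:
  fixes \<delta> L B s :: real
  assumes U: "finite U" "card U = 2 ^ n" "S \<subseteq> U"
    and t: "0 < t" and \<delta>: "0 < \<delta>" "\<delta> \<le> 1 / 3" and L: "0 \<le> L" "L \<le> real (card S)"
    and N: "4 / \<delta> \<le> real (card S)"
    and boost: "\<And>i. i \<in> {start_level \<delta> L..n} \<Longrightarrow> boost U (level_law M R i) (2 ^ i) \<le> B"
    and B: "1 \<le> B"
    and ts: "2 * (real_of_int (cutoff \<delta> B))\<^sup>2 / 9 * ln (5 * exp s) \<le> real t"
  shows "1 - exp (- s) \<le> prob {\<omega> \<in> space M. \<exists>v. approx_count n t \<delta> L B S (\<lambda>i j. R i j \<omega>) = Some v \<and>
      v \<in> {(1 - \<delta>) * real (card S)..(1 + \<delta>) * real (card S)}}"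
    (is "_ \<le> prob ?G")
proof -
  define N where "N = real (card S)"
  define b where "b = cutoff \<delta> B"
  define A where "A = (\<lambda>i \<omega>. capped_avg t b S (\<lambda>i j. R i j \<omega>) i)"
  define E where "E = (\<lambda>i. expectation (\<lambda>\<omega>. min (real_of_int b) (real (card (S \<inter> R i 1 \<omega>)))))"
  \<comment> \<open>Hoeffding bound for the deviation 3/2; the exponent is
    \<open>- 9 * t / (2 * b\<^sup>2)\<close>, which matches the condition on
    \<open>t\<close>.\<close>
  define p where "p = exp (- 2 * real t * (3 / 2)\<^sup>2 / b\<^sup>2)"
  have N4: "4 / \<delta> \<le> N" using N by (simp add: N_def)
  have "12 \<le> 4 / \<delta>" using \<delta> by (simp add: field_simps)
  then have N12: "12 \<le> N" using N4 by linarith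
  obtain q where q: "2 ^ q \<le> \<delta> * N / 4" "\<delta> * N / 4 < 2 ^ Suc q"
    using crossing_level[of "\<delta> * N / 4"] N4 \<delta> by (auto simp: field_simps)
  have start: "start_level \<delta> L \<le> q"
  proof (rule start_level_le)
    have "\<delta> * L / 4 \<le> \<delta> * N / 4" using L \<delta> by (simp add: N_def)
    then show "\<delta> * L / 4 < 2 ^ Suc q" using q(2) by linarith
  qed (use \<delta> L in auto)
  \<comment> \<open>Even \<open>12 * 2 ^ q \<le> N\<close> holds; the factor 8 suffices to show that
    levels \<open>q\<close>, \<open>q + 1\<close> and \<open>q + 2\<close> all exist.\<close>
  have "\<delta> * N \<le> 1 / 3 * N" using \<delta> N12 by (intro mult_right_mono) auto
  then have qN: "2 ^ q * 8 \<le> N" using q(1) zero_le_power[of "2 :: real" q] by linarith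
  have "card S \<le> 2 ^ n" using card_mono[OF U(1,3)] U(2) by simp
  then have "N \<le> 2 ^ n" by (simp add: N_def flip: of_nat_le_iff)
  then have "(2::real) ^ (q + 3) \<le> 2 ^ n" using qN by (simp add: power_add)
  then have qn: "q + 3 \<le> n" by (subst (asm) power_increasing_iff) auto
  have mq: "4 / \<delta> \<le> N / 2 ^ q" "N / 2 ^ q < 8 / \<delta>"
    using q \<delta> by (auto simp: field_simps)
  have b: "8 / \<delta> + 2 * (8 / \<delta> + (8 / \<delta>)\<^sup>2 * (B - 1)) \<le> real_of_int b"
    unfolding b_def cutoff_def Let_def by (rule le_of_int_ceiling)
  have b0: "0 < b"
  proof -
    have "0 < 8 / \<delta> + 2 * (8 / \<delta> + (8 / \<delta>)\<^sup>2 * (B - 1))"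
      using \<delta> B by (intro add_pos_nonneg mult_nonneg_nonneg) auto
    then show ?thesis using b by linarith
  qed
  have E_le: "E i \<le> N / 2 ^ i" if "i \<le> n" for i
    unfolding E_def N_def using U t that by (intro expectation_capped_le) auto
  have E_ge: "N / 2 ^ i - 1 / 8 \<le> E i" if "i \<in> {q, Suc q}" for i
    unfolding E_def N_def
  proof (rule expectation_capped_ge[OF U(1,3)])
    have "(2::real) ^ i \<le> 2 ^ Suc q" using that by (intro power_increasing) auto
    \<comment> \<open>This makes \<open>S\<close> large enough to be admissible in the boost at both
      levels \<open>q\<close> and \<open>q + 1\<close>.\<close>
    then have "2 ^ i \<le> N"
      using qN zero_le_power[of "2 :: real" q] unfolding power_Suc by linarith
    then show "2 ^ i \<le> card S" by (simp add: N_def flip: of_nat_le_iff)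
    show "1 < card S" using N12 by (simp add: N_def)
    show "i \<le> n" "1 \<in> {1..t}" using that qn t by auto
    show "boost U (level_law M R i) (2 ^ i) \<le> B" using that start qn by (intro boost) auto
    have "N / 2 ^ i \<le> N / 2 ^ q" using that N12 by (auto simp: field_simps)
    then show "real (card S) / 2 ^ i \<le> 8 / \<delta>" using mq by (simp add: N_def)
  qed (fact B b)+
  have upper: "prob {\<omega> \<in> space M. E i + 3 / 2 \<le> A i \<omega>} \<le> p"
    and lower: "prob {\<omega> \<in> space M. A i \<omega> \<le> E i - 3 / 2} \<le> p" if "i \<le> n" for i
    using capped_avg_tail[of i b "3 / 2" S] that t b0 by (simp_all add: A_def E_def p_def)
  have A [measurable]: "A i \<in> borel_measurable M" if "i \<le> n" for i
    using that unfolding A_def by simp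
  \<comment> \<open>Two-sided control at \<open>q\<close> and \<open>q + 1\<close> but only an upper
    tail at \<open>q + 2\<close>, where staying below the threshold is enough: five bad events in
    total.\<close>
  define F where "F = (\<Union>i\<in>{q, Suc q, q + 2}. {\<omega> \<in> space M. E i + 3 / 2 \<le> A i \<omega>}) \<union>
    (\<Union>i\<in>{q, Suc q}. {\<omega> \<in> space M. A i \<omega> \<le> E i - 3 / 2})"
  have le: "q \<le> n" "Suc q \<le> n" "q + 2 \<le> n" using qn by auto
  have sets: "{\<omega> \<in> space M. E i + 3 / 2 \<le> A i \<omega>} \<in> events"
      "{\<omega> \<in> space M. A i \<omega> \<le> E i - 3 / 2} \<in> events" if "i \<le> n" for i
    using A[OF that] by measurable
  have F: "F \<in> events" unfolding F_def using sets le by auto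
  have "prob F \<le> prob (\<Union>i\<in>{q, Suc q, q + 2}. {\<omega> \<in> space M. E i + 3 / 2 \<le> A i \<omega>}) +
      prob (\<Union>i\<in>{q, Suc q}. {\<omega> \<in> space M. A i \<omega> \<le> E i - 3 / 2})"
    unfolding F_def using sets le by (intro measure_Un_le) auto
  also have "\<dots> \<le> (\<Sum>i\<in>{q, Suc q, q + 2}. prob {\<omega> \<in> space M. E i + 3 / 2 \<le> A i \<omega>}) +
      (\<Sum>i\<in>{q, Suc q}. prob {\<omega> \<in> space M. A i \<omega> \<le> E i - 3 / 2})"
    using sets le by (intro add_mono finite_measure_subadditive_finite) auto
  also have "\<dots> \<le> (\<Sum>i\<in>{q, Suc q, q + 2}. p) + (\<Sum>i\<in>{q, Suc q}. p)"
    using upper lower le by (intro add_mono sum_mono) auto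
  also have "\<dots> = 5 * p" by simp
  also have "\<dots> \<le> exp (- s)"
  proof -
    \<comment> \<open>The factor 5 inside the logarithm pays for the union bound over the five
      events.\<close>
    have "ln (5 * exp s) \<le> 2 * real t * (3 / 2)\<^sup>2 / b\<^sup>2"
      using ts b0 by (simp add: b_def field_simps power2_eq_square)
    then have "p \<le> exp (- ln (5 * exp s))" by (simp add: p_def)
    also have "\<dots> = exp (- s) / 5" by (simp add: exp_minus field_simps)
    finally show ?thesis by simp
  qed
  finally have "prob F \<le> exp (- s)" .
  moreover have "prob (space M - ?G) \<le> prob F"
  proof (rule finite_measure_mono_AE[OF _ F])
    show "AE \<omega> in M. \<omega> \<in> space M - ?G \<longrightarrow> \<omega> \<in> F"
      using AE_capped_avg_antimono[OF U(1,3), of b]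
    proof eventually_elim
      case (elim \<omega>)
      have "\<omega> \<in> ?G" if \<omega>: "\<omega> \<in> space M" "\<omega> \<notin> F"
      proof -
        have hi: "A i \<omega> < E i + 3 / 2" if "i \<in> {q, Suc q, q + 2}" for i
          using \<omega> that unfolding F_def by fastforce
        have lo: "E i - 3 / 2 < A i \<omega>" if "i \<in> {q, Suc q}" for i
          using \<omega> that unfolding F_def by fastforce
        have "\<exists>v. approx_count n t \<delta> L B S (\<lambda>i j. R i j \<omega>) = Some v \<and> v \<in> {(1 - \<delta>) * N..(1 + \<delta>) * N}"
        proof (rule approx_count_within[where S = S and A = "\<lambda>i. A i \<omega>", folded N_def])
          fix i assume i: "i \<in> {q, Suc q}"
          have "(2::real) ^ i \<le> 2 ^ Suc q" using i by (intro power_increasing) auto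
          \<comment> \<open>The allowed error is thus at least 2, while the actual error is below
            3/2 upwards and, with the truncation loss, below 3/2 + 1/8 downwards.\<close>
          then have "2 * 2 ^ i \<le> \<delta> * N" using q(1) by simp
          then have "2 \<le> \<delta> * (N / 2 ^ i)" by (simp add: field_simps)
          then show "\<bar>A i \<omega> - N / 2 ^ i\<bar> \<le> \<delta> * (N / 2 ^ i)"
            using hi[of i] lo[of i] E_ge[OF i] E_le[of i] i le by (auto simp: abs_le_iff)
        next
          fix i assume i: "i \<in> {q + 2..n}"
          have "A i \<omega> \<le> A (q + 2) \<omega>" using elim i by (simp add: A_def)
          also have "\<dots> < E (q + 2) + 3 / 2" by (rule hi) simp
          also have "E (q + 2) \<le> N / 2 ^ (q + 2)" using le by (intro E_le)
          also have "N / 2 ^ (q + 2) = N / 2 ^ q / 4" by simp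
          also have "N / 2 ^ q / 4 + 3 / 2 \<le> 2 / \<delta> + 3 / 2" using mq(2) by simp
          \<comment> \<open>Equivalent to \<open>11 / 2 \<le> 2 / \<delta>\<close>, and
            \<open>\<delta> \<le> 1 / 3\<close> gives \<open>2 / \<delta> \<ge> 6\<close>.\<close>
          also have "\<dots> \<le> (1 - \<delta>) * (4 / \<delta>)" using \<delta> by (simp add: field_simps)
          finally show "A i \<omega> < (1 - \<delta>) * (4 / \<delta>)" by simp
        qed (use \<delta> L N4 start qn mq in \<open>auto simp: N_def A_def b_def\<close>)
        then show ?thesis using \<omega> by (simp add: N_def)
      qed
      then show ?case by blast
    qed
  qed
  moreover have "prob (space M - ?G) = 1 - prob ?G"
    using N by (intro prob_compl sets_approx_count)
  ultimately show ?thesis by linarith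
qed

end

section \<open>Satisfying assignments in the cube\<close>

theorem theorem4:
  fixes n t :: nat and F :: cnf and M :: "'w measure"
    and R :: "nat \<Rightarrow> nat \<Rightarrow> 'w \<Rightarrow> bool list set"
    and S :: "bool list set" and \<delta> L B s :: real
  assumes "cnf_over n F" and S: "S = sat_set n F"
    and "t > 0"
    and "nested_random_sets M (cube n) n t R"
    and "0 < \<delta>" and "\<delta> \<le> 1 / 3"
    and "0 \<le> L" and "L \<le> real (card S)"
    and "4 / \<delta> \<le> real (card S) \<Longrightarrow>
      (MAX i \<in> {start_level \<delta> L..n}. boost (cube n) (level_law M R i) (2 ^ i)) \<le> B"
    and "4 / \<delta> \<le> real (card S) \<Longrightarrow> 1 \<le> B"
    and "s > 0"
    and "real t \<ge> 2 * (real_of_int (cutoff \<delta> B))\<^sup>2 / 9 * ln (5 * exp s)"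
  shows "\<P>(\<omega> in M. \<exists>v. approx_count n t \<delta> L B S (\<lambda>i j. R i j \<omega>) = Some v \<and>
      v \<in> {(1 - \<delta>) * real (card S)..(1 + \<delta>) * real (card S)}) \<ge> 1 - exp (- s) \<and>
    1 - exp (- s) > 0"
proof
  interpret nested_random_sets M "cube n" n t R by fact
  show "1 - exp (- s) > 0" using \<open>s > 0\<close> by simp
  show "1 - exp (- s) \<le> prob {\<omega> \<in> space M. \<exists>v. approx_count n t \<delta> L B S (\<lambda>i j. R i j \<omega>) = Some v \<and>
      v \<in> {(1 - \<delta>) * real (card S)..(1 + \<delta>) * real (card S)}}"
  proof (cases "4 / \<delta> \<le> real (card S)")
    case True
    have cube: "cube n = {xs. set xs \<subseteq> UNIV \<and> length xs = n}" by (simp add: cube_def)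
    show ?thesis
    proof (rule approx_count_prob)
      show "finite (cube n)" "card (cube n) = 2 ^ n"
        unfolding cube by (simp_all only: finite_lists_length_eq card_lists_length_eq finite card_UNIV_bool)
      show "S \<subseteq> cube n" by (auto simp: S sat_set_def)
      fix i assume "i \<in> {start_level \<delta> L..n}"
      then have "boost (cube n) (level_law M R i) (2 ^ i)
          \<le> (MAX i \<in> {start_level \<delta> L..n}. boost (cube n) (level_law M R i) (2 ^ i))"
        by (intro Max_ge) auto
      with assms(9)[OF True] show "boost (cube n) (level_law M R i) (2 ^ i) \<le> B" by linarith
    qed (use assms True in auto)
  next
    case False
    \<comment> \<open>Here the exact count is returned, so success is the whole space.\<close>
    have "0 \<le> \<delta> * real (card S)" using \<open>0 < \<delta>\<close> by simp
    then have "{\<omega> \<in> space M. \<exists>v. approx_count n t \<delta> L B S (\<lambda>i j. R i j \<omega>) = Some v \<and>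
      v \<in> {(1 - \<delta>) * real (card S)..(1 + \<delta>) * real (card S)}} = space M"
      using False by (auto simp: approx_count_def algebra_simps)
    then show ?thesis by (simp add: prob_space)
  qed
qed

end
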